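(* Let $K\subset\mathbb{R}^n$ be a convex body, let $1\le k\le n-1$, let $\boldsymbol{\nu}=(\nu_1,\dots,\nu_k)$ be an orthonormal family in $\mathbb{R}^n$, and define $$F(u,\boldsymbol{\lambda})=h_K\Bigl(u+\sum_{j=1}^k\lambda_j\nu_j\Bigr),\qquad(u,\boldsymbol{\lambda})\in E_{n-k}\times\mathbb{R}^k.$$ Assume that, near the point $(u,\mathbf{p}_k)\in E_{n-k}\times\mathbb{R}^k$ under consideration, the minimizer $\boldsymbol{\lambda}=\boldsymbol{\lambda}(u,\mathbf{p}_k)$ over $\boldsymbol{\lambda}\in\mathbb{R}^k$ of $$F(u,\boldsymbol{\lambda})-\boldsymbol{\lambda}\cdot\mathbf{p}_k$$ exists, is unique and depends smoothly on $(u,\mathbf{p}_k)$, that $F$ is $C^2$ near the corresponding point $(u,\boldsymbol{\lambda}(u,\mathbf{p}_k))$, and that $F_{\boldsymbol{\lambda}\boldsymbol{\lambda}}$ is invertible at the minimizer. Then $$\det\left(D^2_{(u,\mathbf{p}_k)}h^{(k)}_{\boldsymbol{\nu}}\right)=(-1)^k\,\frac{\det(F_{uu})}{\det(F_{\boldsymbol{\lambda}\boldsymbol{\lambda}})},$$ where all derivatives of $F$ are evaluated at $(u,\boldsymbol{\lambda}(u,\mathbf{p}_k))$.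
   Context: The support function is $h_K(v)=\sup_{x\in K}x\cdot v$, $v\in\mathbb{R}^n$. $E_{n-k}=\operatorname{span}\{\nu_1,\dots,\nu_k\}^\perp$. For $\mathbf{p}_k=(p_1,\dots,p_k)\in\mathbb{R}^k$ let $K^{(k)}(\boldsymbol{\nu},\mathbf{p}_k)=K\cap\bigcap_{j=1}^k\{x\in\mathbb{R}^n:x\cdot\nu_j=p_j\}$. The $k$-th iterated slicing support function is $h^{(k)}_{\boldsymbol{\nu}}(u,\mathbf{p}_k)=\sup_{x\in K^{(k)}(\boldsymbol{\nu},\mathbf{p}_k)}x\cdot u$ for $u\in E_{n-k}$, with value $-\infty$ if $K^{(k)}(\boldsymbol{\nu},\mathbf{p}_k)=\emptyset$. After choosing an orthonormal basis of $E_{n-k}$ and writing $u=(u_1,\dots,u_{n-k})$, the full Hessian $D^2_{(u,\mathbf{p}_k)}h^{(k)}_{\boldsymbol{\nu}}$ is the $n\times n$ matrix of second partial derivatives of $h^{(k)}_{\boldsymbol{\nu}}$ with respect to all variables $(u_1,\dots,u_{n-k},p_1,\dots,p_k)$. Likewise $F_{uu}=\bigl(\partial^2F/\partial u_\alpha\partial u_\beta\bigr)_{1\le\alpha,\beta\le n-k}$ and $F_{\boldsymbol{\lambda}\boldsymbol{\lambda}}=\bigl(\partial^2F/\partial\lambda_i\partial\lambda_j\bigr)_{1\le i,j\le k}$. *)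

theory Defs
  imports "HOL-Analysis.Analysis"
begin

section \<open>Convex bodies, support functions and slices\<close>

text \<open>
  Convention: a convex body is a nonempty compact convex set. Interior points are not required,
  so that the more restrictive convention (nonempty interior) is covered as well.
\<close>

definition convex_body :: "'a::euclidean_space set \<Rightarrow> bool" where
  "convex_body K \<longleftrightarrow> compact K \<and> convex K \<and> K \<noteq> {}"

definition support_fun :: "'a::euclidean_space set \<Rightarrow> 'a \<Rightarrow> real" where
  "support_fun K v = (SUP x\<in>K. x \<bullet> v)"

definition orthonormal_family :: "('i \<Rightarrow> 'a::euclidean_space) \<Rightarrow> bool" where
  "orthonormal_family b \<longleftrightarrow> (\<forall>i j. b i \<bullet> b j = (if i = j then 1 else 0))"

text \<open>
  A family \<open>\<nu>\<^sub>1, \<dots>, \<nu>\<^sub>k\<close> is indexed by a finite type \<open>'k\<close> with \<open>CARD('k) = k\<close>; the parameters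
  \<open>(p\<^sub>1, \<dots>, p\<^sub>k)\<close> then form a vector in \<open>real ^ 'k\<close>.
\<close>

definition slice ::
    "'a::euclidean_space set \<Rightarrow> ('k::finite \<Rightarrow> 'a) \<Rightarrow> real ^ 'k \<Rightarrow> 'a set" where
  "slice K \<nu> p = K \<inter> (\<Inter>j. {x. x \<bullet> \<nu> j = p $ j})"

text \<open>The supremum is taken in the extended reals, hence equals \<open>-\<infinity>\<close> on an empty slice.\<close>

definition slicing_support ::
    "'a::euclidean_space set \<Rightarrow> ('k::finite \<Rightarrow> 'a) \<Rightarrow> 'a \<Rightarrow> real ^ 'k \<Rightarrow> ereal" where
  "slicing_support K \<nu> u p = (SUP x\<in>slice K \<nu> p. ereal (x \<bullet> u))"

definition lifted_support ::
    "'a::euclidean_space set \<Rightarrow> ('k::finite \<Rightarrow> 'a) \<Rightarrow> 'a \<Rightarrow> real ^ 'k \<Rightarrow> real" where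
  "lifted_support K \<nu> u l = support_fun K (u + (\<Sum>j\<in>UNIV. l $ j *\<^sub>R \<nu> j))"

section \<open>Coordinates, regularity and Hessians\<close>

text \<open>
  Given a basis \<open>e\<close> of a subspace \<open>E\<close>, a function on \<open>E \<times> \<real>\<^sup>k\<close> is expressed through the
  coordinates \<open>c\<close> of the first argument with respect to \<open>e\<close>.
\<close>

definition in_coords ::
    "('m::finite \<Rightarrow> 'a::real_vector) \<Rightarrow> ('a \<Rightarrow> real ^ 'k \<Rightarrow> 'b) \<Rightarrow> (real ^ 'm) \<times> (real ^ 'k) \<Rightarrow> 'b" where
  "in_coords e G = (\<lambda>(c, q). G (\<Sum>a\<in>UNIV. c $ a *\<^sub>R e a) q)"

text \<open>
  \<open>C_k_on r f S\<close>, for open \<open>S\<close>, says that \<open>f\<close> is of class \<open>C\<^sup>r\<close> on \<open>S\<close>. Since the domain has finite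
  dimension, regularity of the derivative is tested on each fixed direction \<open>v\<close>.
\<close>

primrec C_k_on ::
    "nat \<Rightarrow> ('a::euclidean_space \<Rightarrow> 'b::real_normed_vector) \<Rightarrow> 'a set \<Rightarrow> bool" where
  "C_k_on 0 f S \<longleftrightarrow> continuous_on S f"
| "C_k_on (Suc r) f S \<longleftrightarrow>
     (\<forall>x\<in>S. f differentiable (at x)) \<and> (\<forall>v. C_k_on r (\<lambda>x. frechet_derivative f (at x) v) S)"

definition partial_deriv :: "'v::real_vector \<Rightarrow> ('v \<Rightarrow> real) \<Rightarrow> 'v \<Rightarrow> real" where
  "partial_deriv b f x = deriv (\<lambda>t. f (x + t *\<^sub>R b)) 0"

definition hessian ::
    "('i::finite \<Rightarrow> 'v::real_vector) \<Rightarrow> ('v \<Rightarrow> real) \<Rightarrow> 'v \<Rightarrow> real ^ 'i ^ 'i" where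
  "hessian b f x = (\<chi> i j. partial_deriv (b i) (partial_deriv (b j) f) x)"

definition fst_dirs :: "'m::finite \<Rightarrow> (real ^ 'm) \<times> (real ^ 'k::finite)" where
  "fst_dirs a = (axis a 1, 0)"

definition snd_dirs :: "'k::finite \<Rightarrow> (real ^ 'm::finite) \<times> (real ^ 'k)" where
  "snd_dirs j = (0, axis j 1)"

definition all_dirs :: "'m::finite + 'k::finite \<Rightarrow> (real ^ 'm) \<times> (real ^ 'k)" where
  "all_dirs = case_sum fst_dirs snd_dirs"

end

theory Submission
  imports Defs
begin

text \<open>
  Near \<open>(u, p)\<close> the function \<open>h\<close> is minus the Legendre transform of \<open>F\<close> in the second variable:
  \<open>h (v, q) = F (v, \<Lambda>) - \<Lambda> \<bullet> q\<close> with \<open>F\<^sub>\<lambda> (v, \<Lambda>) = q\<close>. Hence the gradient of \<open>h\<close> is \<open>(F\<^sub>u, - \<Lambda>)\<close>,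
  evaluated along the \<open>C\<^sup>1\<close> map \<open>\<Lambda>\<close>, so \<open>h\<close> is \<open>C\<^sup>2\<close>. Writing \<open>P\<close> and \<open>Q\<close> for the derivatives of
  \<open>\<Lambda>\<close> in \<open>u\<close> and \<open>p\<close>, and \<open>C = F\<^sub>\<lambda>\<^sub>u\<close>, the Hessian of \<open>h\<close> has the block rows \<open>(F\<^sub>u\<^sub>u + P C, - P)\<close>
  and \<open>(Q C, - Q)\<close>. It is the product of the matrices with rows \<open>(F\<^sub>u\<^sub>u, - P)\<close>, \<open>(0, - Q)\<close> and
  \<open>(1, 0)\<close>, \<open>(- C, 1)\<close>; differentiating the critical point equation in \<open>q\<close> gives \<open>Q F\<^sub>\<lambda>\<^sub>\<lambda> = 1\<close>.
\<close>

section \<open>Determinants of block matrices\<close>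

text \<open>In the Leibniz sum, a permutation moving some index outside \<open>range f\<close> picks
  a zero of a unit row, so only the permutations of \<open>range f\<close> contribute. Transport
  along \<open>f\<close> matches these with the permutations of \<open>'c\<close> and preserves
  signs.\<close>

lemma det_principal_submatrix:
  fixes M :: "'a::comm_ring_1 ^ 'b ^ 'b" and f :: "'c::finite \<Rightarrow> 'b"
  assumes "inj f" and rows: "\<And>i. i \<notin> range f \<Longrightarrow> M $ i = axis i 1"
  shows "det M = det (\<chi> i j. M $ f i $ f j)"
proof -
  let ?t = "\<lambda>p. of_int (sign p) * (\<Prod>i\<in>UNIV. M $ i $ p i) :: 'a"
  let ?R = "range f" and ?m = "map_permutation UNIV f"
  have bij: "bij_betw f UNIV ?R"
    using \<open>inj f\<close> by (simp add: bij_betw_def)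
  have zero: "?t p = 0" if p: "p permutes UNIV" "\<not> p permutes ?R" for p
  proof -
    obtain i where "i \<notin> ?R" "p i \<noteq> i"
      using permutes_superset[OF p(1), of ?R] p(2) by blast
    then have "M $ i $ p i = 0"
      using rows by (simp add: axis_def)
    then have "(\<Prod>i\<in>UNIV. M $ i $ p i) = 0"
      by (intro prod_zero) auto
    then show ?thesis by simp
  qed
  have "det M = (\<Sum>p | p permutes ?R. ?t p)"
    unfolding det_def
    by (intro sum.mono_neutral_right)
      (auto simp: finite_permutations intro: permutes_subset zero)
  also have "\<dots> = (\<Sum>q | q permutes UNIV. ?t (?m q))"
  proof (rule sum.reindex_bij_witness[where i = ?m and j = "map_permutation ?R (inv f)"])
    fix p assume p: "p \<in> {p. p permutes ?R}"
    show "?m (map_permutation ?R (inv f) p) = p"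
      using p \<open>inj f\<close> bij_betw_inv_into[OF bij]
      by (intro map_permutation_compose_inv) (auto simp: f_inv_into_f)
    show "map_permutation ?R (inv f) p \<in> {q. q permutes UNIV}"
      using p bij_betw_inv_into[OF bij] by (auto intro: map_permutation_permutes)
    show "?t (?m (map_permutation ?R (inv f) p)) = ?t p"
      using \<open>?m (map_permutation ?R (inv f) p) = p\<close> by simp
  next
    fix q assume q: "q \<in> {q. q permutes (UNIV :: 'c set)}"
    show "map_permutation ?R (inv f) (?m q) = q"
      using q \<open>inj f\<close> bij by (intro map_permutation_compose_inv) auto
    show "?m q \<in> {p. p permutes ?R}"
      using q bij by (auto intro: map_permutation_permutes)
  qed
  also have "\<dots> = (\<Sum>q | q permutes UNIV. of_int (sign q) * (\<Prod>i\<in>UNIV. M $ f i $ f (q i)))"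
  proof (rule sum.cong)
    fix q assume q: "q \<in> {q. q permutes (UNIV :: 'c set)}"
    then have "?m q permutes ?R"
      using bij by (auto intro: map_permutation_permutes)
    then have "(\<Prod>i\<in>UNIV. M $ i $ ?m q i) = (\<Prod>i\<in>?R. M $ i $ ?m q i)"
      by (intro prod.mono_neutral_right) (auto simp: rows permutes_not_in)
    also have "\<dots> = (\<Prod>i\<in>UNIV. M $ f i $ f (q i))"
      using \<open>inj f\<close> by (simp add: prod.reindex map_permutation_apply)
    finally show "?t (?m q) = of_int (sign q) * (\<Prod>i\<in>UNIV. M $ f i $ f (q i))"
      using q \<open>inj f\<close> by (simp add: sign_map_permutation)
  qed simp
  finally show ?thesis
    by (simp add: det_def)
qed

text \<open>The sum type as index set is that of \<open>all_dirs\<close>, so the full Hessian can be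
  compared with a block matrix entry by entry.\<close>

definition block_matrix ::
    "'a ^ 'm ^ 'm \<Rightarrow> 'a ^ 'k ^ 'm \<Rightarrow> 'a ^ 'm ^ 'k \<Rightarrow> 'a ^ 'k ^ 'k
      \<Rightarrow> 'a ^ ('m::finite + 'k::finite) ^ ('m + 'k)" where
  "block_matrix A B C D = (\<chi> i j.
     case i of
       Inl i \<Rightarrow> (case j of Inl j \<Rightarrow> A $ i $ j | Inr j \<Rightarrow> B $ i $ j)
     | Inr i \<Rightarrow> (case j of Inl j \<Rightarrow> C $ i $ j | Inr j \<Rightarrow> D $ i $ j))"

lemma block_matrix_nth [simp]:
  "block_matrix A B C D $ Inl i $ Inl j = A $ i $ j"
  "block_matrix A B C D $ Inl i $ Inr j' = B $ i $ j'"
  "block_matrix A B C D $ Inr i' $ Inl j = C $ i' $ j"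
  "block_matrix A B C D $ Inr i' $ Inr j' = D $ i' $ j'"
  by (simp_all add: block_matrix_def)

lemma sum_UNIV_sum:
  "(\<Sum>x\<in>UNIV. g x) = (\<Sum>a\<in>UNIV. g (Inl a)) + (\<Sum>b\<in>UNIV. g (Inr b))"
  for g :: "'m::finite + 'k::finite \<Rightarrow> 'a::comm_monoid_add"
  unfolding UNIV_sum by (subst sum.union_disjoint) (auto simp: sum.reindex)

lemma vec_eq_sum_iff:
  "x = y \<longleftrightarrow> (\<forall>a. x $ Inl a = y $ Inl a) \<and> (\<forall>b. x $ Inr b = y $ Inr b)"
  for x y :: "'a ^ ('m::finite + 'k::finite)"
  by (auto simp: vec_eq_iff split_sum_all)

lemma block_matrix_mult:
  fixes A A' :: "'a::semiring_1 ^ 'm ^ 'm" and D D' :: "'a ^ 'k ^ 'k"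
  shows "block_matrix A B C D ** block_matrix A' B' C' D' =
    block_matrix (A ** A' + B ** C') (A ** B' + B ** D') (C ** A' + D ** C') (C ** B' + D ** D')"
  by (simp add: vec_eq_sum_iff matrix_matrix_mult_def sum_UNIV_sum)

text \<open>The matrix factors into one with diagonal blocks \<open>mat 1\<close> and
  \<open>D\<close> and one with lower rows \<open>0\<close> and \<open>mat 1\<close>. In each factor
  one group of rows consists of unit rows, and striking these leaves \<open>D\<close> and
  \<open>A\<close> respectively.\<close>

lemma det_block_matrix_upper:
  fixes A :: "'a::comm_ring_1 ^ 'm ^ 'm" and D :: "'a ^ 'k ^ 'k"
  shows "det (block_matrix A B 0 D) = det A * det D"
proof -
  have "block_matrix A B 0 D = block_matrix (mat 1) 0 0 D ** block_matrix A B 0 (mat 1)"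
    by (simp add: block_matrix_mult)
  moreover have "det (block_matrix A B 0 (mat 1)) = det A"
  proof (subst det_principal_submatrix[where f = Inl])
    fix i :: "'m + 'k" assume "i \<notin> range Inl"
    then show "block_matrix A B 0 (mat 1) $ i = axis i 1"
      by (cases i) (auto simp: vec_eq_sum_iff axis_def mat_def)
  qed simp_all
  moreover have "det (block_matrix (mat 1 :: 'a ^ 'm ^ 'm) 0 0 D) = det D"
  proof (subst det_principal_submatrix[where f = Inr])
    fix i :: "'m + 'k" assume "i \<notin> range Inr"
    then show "block_matrix (mat 1) 0 0 D $ i = axis i 1"
      by (cases i) (auto simp: vec_eq_sum_iff axis_def mat_def)
  qed simp_all
  ultimately show ?thesis
    by (simp add: det_mul)
qed

text \<open>The upper rows are unit rows; striking them leaves an identity matrix. This handles the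
  second factor of the Hessian.\<close>

lemma det_block_matrix_unit_lower:
  fixes C :: "'a::comm_ring_1 ^ 'm ^ 'k"
  shows "det (block_matrix (mat 1) 0 C (mat 1)) = 1"
proof (subst det_principal_submatrix[where f = Inr])
  fix i :: "'m + 'k" assume "i \<notin> range Inr"
  then show "block_matrix (mat 1) 0 C (mat 1) $ i = axis i 1"
    by (cases i) (auto simp: vec_eq_sum_iff axis_def mat_def)
qed simp_all

lemma matrix_minus_mult_minus: "- A ** - B = A ** B"
  for A :: "'a::ring_1 ^ 'n ^ 'm" and B :: "'a ^ 'k ^ 'n"
  by (simp add: matrix_matrix_mult_def)

lemma det_minus_mat_1: "det (- mat 1 :: 'a::comm_ring_1 ^ 'k ^ 'k) = (-1) ^ CARD('k)"
  by (subst det_diagonal) (auto simp: mat_def)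

section \<open>Differentiability and Hessians\<close>

lemma C_k_on_cong:
  assumes "open S" "\<And>x. x \<in> S \<Longrightarrow> f x = g x" "C_k_on r f S"
  shows "C_k_on r g S"
  using assms(2,3)
proof (induction r arbitrary: f g)
  case 0
  then show ?case by (auto cong: continuous_on_cong)
next
  case (Suc r)
  have D: "(g has_derivative frechet_derivative f (at x)) (at x)" if "x \<in> S" for x
    using Suc.prems that \<open>open S\<close>
    by (auto intro: has_derivative_transform_within_open simp: frechet_derivative_works)
  have "C_k_on r (\<lambda>x. frechet_derivative g (at x) v) S" for v
  proof (rule Suc.IH)
    show "C_k_on r (\<lambda>x. frechet_derivative f (at x) v) S"
      using Suc.prems by simp
    show "frechet_derivative f (at x) v = frechet_derivative g (at x) v" if "x \<in> S" for x
      using frechet_derivative_at[OF D[OF that]] by simp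
  qed
  then show ?case
    using D by (auto simp: differentiable_def)
qed

lemma C_k_on_subset:
  assumes "C_k_on r f S" "T \<subseteq> S"
  shows "C_k_on r f T"
  using assms
proof (induction r arbitrary: f)
  case 0
  then show ?case by (auto intro: continuous_on_subset)
next
  case (Suc r)
  then show ?case unfolding C_k_on.simps by blast
qed

text \<open>Regularity may be tested on an explicit formula for the derivative, since on an open set
  it coincides with \<open>frechet_derivative\<close> at every point.\<close>

lemma C_k_on_SucI:
  assumes "open S" "\<And>x. x \<in> S \<Longrightarrow> (f has_derivative f' x) (at x)"
    "\<And>v. C_k_on r (\<lambda>x. f' x v) S"
  shows "C_k_on (Suc r) f S"
proof -
  have "C_k_on r (\<lambda>x. frechet_derivative f (at x) v) S" for v
    by (rule C_k_on_cong[OF assms(1) _ assms(3)[of v]])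
      (simp add: frechet_derivative_at[OF assms(2), symmetric])
  then show ?thesis
    using assms(2) by (auto simp: differentiable_def)
qed

lemma C_k_on_Suc_has_derivative:
  assumes "C_k_on (Suc r) f S" "x \<in> S"
  shows "(f has_derivative frechet_derivative f (at x)) (at x)"
  using assms by (simp add: frechet_derivative_works[symmetric])

lemma C_k_on_Suc_frechet_derivative:
  assumes "C_k_on (Suc r) f S"
  shows "C_k_on r (\<lambda>x. frechet_derivative f (at x) v) S"
  using assms by simp

lemma C_1_on_continuous_on:
  assumes "C_k_on 1 f S"
  shows "continuous_on S f"
  using assms
  by (auto intro!: continuous_at_imp_continuous_on differentiable_imp_continuous_within)

text \<open>\<open>C_k_on\<close> gives continuity of a derivative only in fixed directions, while
  the chain rule evaluates it in directions that move with the point. Expanding \<open>z x\<close>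
  in the finite basis reduces the second situation to the first.\<close>

lemma continuous_on_linear_family:
  fixes L :: "'b \<Rightarrow> 'a::euclidean_space \<Rightarrow> 'c::real_normed_vector"
  assumes lin: "\<And>y. y \<in> V \<Longrightarrow> linear (L y)"
    and L: "\<And>v. continuous_on S (\<lambda>x. L (\<phi> x) v)"
    and z: "continuous_on S z" and sub: "\<phi> ` S \<subseteq> V"
  shows "continuous_on S (\<lambda>x. L (\<phi> x) (z x))"
proof -
  have "L (\<phi> x) (z x) = (\<Sum>b\<in>Basis. (z x \<bullet> b) *\<^sub>R L (\<phi> x) b)" if "x \<in> S" for x
  proof -
    have "linear (L (\<phi> x))" using lin sub that by blast
    then show ?thesis
      by (subst euclidean_representation[of "z x", symmetric])
        (simp add: linear_sum linear_scale del: euclidean_representation)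
  qed
  moreover have "continuous_on S (\<lambda>x. \<Sum>b\<in>Basis. (z x \<bullet> b) *\<^sub>R L (\<phi> x) b)"
    by (intro continuous_intros L z)
  ultimately show ?thesis
    by (simp cong: continuous_on_cong)
qed

lemma partial_deriv_eq:
  assumes "(f has_derivative f') (at x)"
  shows "partial_deriv b f x = f' b"
proof -
  interpret f': bounded_linear f'
    using assms by (rule has_derivative_bounded_linear)
  have "((\<lambda>t. x + t *\<^sub>R b) has_derivative (\<lambda>t. t *\<^sub>R b)) (at 0)"
    by (auto intro!: derivative_eq_intros)
  from has_derivative_compose[OF this, of f f'] assms
  have "((\<lambda>t. f (x + t *\<^sub>R b)) has_derivative (\<lambda>t. f' (t *\<^sub>R b))) (at 0)"
    by simp
  then have "((\<lambda>t. f (x + t *\<^sub>R b)) has_field_derivative f' b) (at 0)"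
    by (simp add: has_field_derivative_def f'.scaleR mult_commute_abs)
  then show ?thesis
    unfolding partial_deriv_def by (rule DERIV_imp_deriv)
qed

text \<open>The inner partial derivative equals \<open>f' y b\<close> on a whole neighbourhood of
  \<open>x\<close>, so the outer derivative may be taken of that formula.\<close>

lemma partial_deriv_partial_deriv_eq:
  assumes "open S" "x \<in> S" "\<And>y. y \<in> S \<Longrightarrow> (f has_derivative f' y) (at y)"
    and "((\<lambda>y. f' y b) has_derivative g) (at x)"
  shows "partial_deriv c (partial_deriv b f) x = g c"
proof (rule partial_deriv_eq)
  show "(partial_deriv b f has_derivative g) (at x)"
    by (rule has_derivative_transform_within_open[OF assms(4,1,2)])
      (simp add: partial_deriv_eq[OF assms(3)])
qed

section \<open>Partial Legendre transforms\<close>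

text \<open>This is the purely differential part: convexity enters only later, through the critical
  point equation and the formula for \<open>H\<close>. The determinant identity is kept free of
  quotients.\<close>

lemma partial_legendre_transform:
  fixes F :: "(real ^ 'm) \<times> (real ^ 'k) \<Rightarrow> real" and \<Lambda> :: "(real ^ 'm) \<times> (real ^ 'k) \<Rightarrow> real ^ 'k"
  assumes N: "open N" and V: "open V" and sub: "\<And>x. x \<in> N \<Longrightarrow> (fst x, \<Lambda> x) \<in> V"
    and F: "C_k_on 2 F V" and \<Lambda>: "C_k_on 1 \<Lambda> N"
    and critical: "\<And>x b. x \<in> N \<Longrightarrow> frechet_derivative F (at (fst x, \<Lambda> x)) (0, b) = b \<bullet> snd x"
    and H: "\<And>x. x \<in> N \<Longrightarrow> H x = F (fst x, \<Lambda> x) - \<Lambda> x \<bullet> snd x"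
  shows "C_k_on 2 H N"
    and "w \<in> N \<Longrightarrow> det (hessian all_dirs H w) * det (hessian snd_dirs F (fst w, \<Lambda> w)) =
           (-1) ^ CARD('k) * det (hessian fst_dirs F (fst w, \<Lambda> w))"
proof -
  define \<Phi> where "\<Phi> x = (fst x, \<Lambda> x)" for x
  define F' where "F' y = frechet_derivative F (at y)" for y
  define F'' where "F'' b y = frechet_derivative (\<lambda>y. F' y b) (at y)" for b y
  define L where "L x = frechet_derivative \<Lambda> (at x)" for x
  \<comment> \<open>This is the chain rule candidate for the derivative, in direction
    \<open>c\<close>, of the component of the gradient of \<open>H\<close> along
    \<open>b\<close>.\<close>
  define H'' where "H'' b x c = F'' (fst b, 0) (\<Phi> x) (fst c, L x c) - L x c \<bullet> snd b" for b x c
  have \<Phi>V: "\<Phi> x \<in> V" if "x \<in> N" for x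
    using sub that by (simp add: \<Phi>_def)
  have F_D: "(F has_derivative F' y) (at y)" if "y \<in> V" for y
    using F that unfolding F'_def numeral_2_eq_2 by (rule C_k_on_Suc_has_derivative)
  have F'_C1: "C_k_on 1 (\<lambda>y. F' y b) V" for b
    using F unfolding numeral_2_eq_2 One_nat_def F'_def by (rule C_k_on_Suc_frechet_derivative)
  have F'_D: "((\<lambda>y. F' y b) has_derivative F'' b y) (at y)" if "y \<in> V" for b y
    using F'_C1 that unfolding F''_def One_nat_def by (rule C_k_on_Suc_has_derivative)
  have F''_cont: "continuous_on V (\<lambda>y. F'' b y c)" for b c
    using C_k_on_Suc_frechet_derivative[of 0, OF F'_C1[unfolded One_nat_def]]
    by (simp add: F''_def)
  have F'_linear: "linear (F' y)" if "y \<in> V" for y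
    using F_D[OF that] has_derivative_linear by blast
  have F''_linear: "linear (F'' b y)" if "y \<in> V" for b y
    using F'_D[OF that] has_derivative_linear by blast
  have \<Lambda>_D: "(\<Lambda> has_derivative L x) (at x)" if "x \<in> N" for x
    using \<Lambda> that unfolding L_def One_nat_def by (rule C_k_on_Suc_has_derivative)
  have L_cont: "continuous_on N (\<lambda>x. L x c)" for c
    using C_k_on_Suc_frechet_derivative[of 0, OF \<Lambda>[unfolded One_nat_def]]
    by (simp add: L_def)
  have \<Phi>_cont: "continuous_on N \<Phi>"
    unfolding \<Phi>_def by (intro continuous_intros C_1_on_continuous_on \<Lambda>)
  have \<Phi>_D: "(\<Phi> has_derivative (\<lambda>c. (fst c, L x c))) (at x)" if "x \<in> N" for x
    unfolding \<Phi>_def by (auto intro!: derivative_eq_intros \<Lambda>_D that)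
  have F'\<Phi>_D: "((\<lambda>x. F' (\<Phi> x) b) has_derivative (\<lambda>c. F'' b (\<Phi> x) (fst c, L x c))) (at x)"
    if "x \<in> N" for x b
    using has_derivative_compose[OF \<Phi>_D[OF that] F'_D[OF \<Phi>V[OF that]]] .
  have H_D: "(H has_derivative (\<lambda>b. F' (\<Phi> x) (fst b, 0) - \<Lambda> x \<bullet> snd b)) (at x)"
    if x: "x \<in> N" for x
  proof (rule has_derivative_transform_within_open[OF _ N x])
    \<comment> \<open>Envelope argument: by criticality the variation of \<Lambda> contributes
      \<open>L x b \<bullet> snd x\<close>, which cancels against the same term in the derivative of
      \<open>\<Lambda> x \<bullet> snd x\<close>.\<close>
    have split: "F' (\<Phi> x) (fst b, L x b) = F' (\<Phi> x) (fst b, 0) + L x b \<bullet> snd x" for b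
    proof -
      have "F' (\<Phi> x) (fst b, L x b) = F' (\<Phi> x) ((fst b, 0) + (0, L x b))"
        by simp
      also have "\<dots> = F' (\<Phi> x) (fst b, 0) + F' (\<Phi> x) (0, L x b)"
        by (rule linear_add[OF F'_linear[OF \<Phi>V[OF x]]])
      finally show ?thesis
        using critical[OF x] by (simp add: F'_def \<Phi>_def)
    qed
    have "((\<lambda>x. F (\<Phi> x)) has_derivative (\<lambda>c. F' (\<Phi> x) (fst c, L x c))) (at x)"
      using has_derivative_compose[OF \<Phi>_D[OF x] F_D[OF \<Phi>V[OF x]]] .
    then show "((\<lambda>x. F (\<Phi> x) - \<Lambda> x \<bullet> snd x) has_derivative
        (\<lambda>b. F' (\<Phi> x) (fst b, 0) - \<Lambda> x \<bullet> snd b)) (at x)"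
      by (auto intro!: derivative_eq_intros \<Lambda>_D x simp: split algebra_simps)
  qed (simp add: H \<Phi>_def)
  have H'_D: "((\<lambda>x. F' (\<Phi> x) (fst b, 0) - \<Lambda> x \<bullet> snd b) has_derivative H'' b x) (at x)"
    if "x \<in> N" for x b
    unfolding H''_def by (auto intro!: derivative_eq_intros F'\<Phi>_D \<Lambda>_D that)
  have "continuous_on N (\<lambda>x. F'' b (\<Phi> x) (fst c, L x c))" for b c
  proof (rule continuous_on_linear_family[where L = "F'' b" and V = V])
    show "continuous_on N (\<lambda>x. F'' b (\<Phi> x) v)" for v
      using \<Phi>V by (intro continuous_on_compose2[OF F''_cont \<Phi>_cont]) auto
    show "continuous_on N (\<lambda>x. (fst c, L x c))"
      by (intro continuous_intros L_cont)
  qed (use F''_linear \<Phi>V in auto)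
  then have "continuous_on N (\<lambda>x. H'' b x c)" for b c
    unfolding H''_def by (intro continuous_on_diff continuous_on_inner L_cont continuous_on_const)
  then show "C_k_on 2 H N"
    unfolding numeral_2_eq_2
    by (intro C_k_on_SucI[OF N H_D] C_k_on_SucI[OF N H'_D]) simp_all

  assume w: "w \<in> N"
  define y where "y = \<Phi> w"
  have y: "y \<in> V" using \<Phi>V w by (simp add: y_def)
  have F''_eq: "partial_deriv c (partial_deriv b F) y = F'' b y c" for b c
    using partial_deriv_partial_deriv_eq[OF V y F_D F'_D[OF y]] .
  have H''_eq: "partial_deriv c (partial_deriv b H) w = H'' b w c" for b c
    using partial_deriv_partial_deriv_eq[OF N w H_D H'_D[OF w]] .
  \<comment> \<open>The critical point equation holds on the open set \<open>N\<close>, so it can be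
    differentiated at \<open>w\<close>; its right-hand side is linear in the point.\<close>
  have critical': "F'' (0, b) y (fst c, L w c) = b \<bullet> snd c" for b c
  proof -
    have "((\<lambda>x. F' (\<Phi> x) (0, b)) has_derivative (\<lambda>c. b \<bullet> snd c)) (at w)"
      by (rule has_derivative_transform_within_open[OF _ N w, where f = "\<lambda>x. b \<bullet> snd x"])
        (auto intro!: derivative_eq_intros simp: critical F'_def \<Phi>_def)
    from fun_cong[OF has_derivative_unique[OF F'\<Phi>_D[OF w] this], of c] show ?thesis
      by (simp add: y_def)
  qed
  have F''_expand: "F'' b y (a, l) = F'' b y (a, 0) + (\<Sum>j\<in>UNIV. l $ j * F'' b y (snd_dirs j))"
    for b a l
  proof -
    have "(a, l) = (a, 0) + (\<Sum>j\<in>UNIV. l $ j *\<^sub>R snd_dirs j)"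
      by (simp add: snd_dirs_def prod_eq_iff fst_sum snd_sum basis_expansion
          flip: scalar_mult_eq_scaleR)
    then show ?thesis
      using F''_linear[OF y, of b] by (simp add: linear_add linear_sum linear_scale)
  qed
  \<comment> \<open>Zero arguments arise because directions in \<open>snd_dirs\<close> have first
    component 0. In the first slot the claim is the derivative at \<open>y\<close> of
    \<open>F' y (0, 0) = 0\<close>, valid throughout \<open>V\<close>.\<close>
  have F''_zero: "F'' (0, 0) y c = 0" "F'' b y (0, 0) = 0" for b c
  proof -
    have "((\<lambda>y. F' y (0, 0)) has_derivative (\<lambda>_. 0)) (at y)"
      by (rule has_derivative_transform_within_open[OF _ V y, where f = "\<lambda>_. 0"])
        (use linear_0[OF F'_linear] in \<open>auto simp: zero_prod_def\<close>)
    from fun_cong[OF has_derivative_unique[OF F'_D[OF y] this], of c]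
    show "F'' (0, 0) y c = 0" .
    show "F'' b y (0, 0) = 0"
      using linear_0[OF F''_linear[OF y, of b]] by (simp add: zero_prod_def)
  qed

  define A where "A = hessian fst_dirs F y"
  define C where "C = (\<chi> i j. partial_deriv (snd_dirs i) (partial_deriv (fst_dirs j) F) y)"
  define D where "D = hessian snd_dirs F y"
  \<comment> \<open>Rows index directions and columns index components of \<Lambda>, so
    \<open>P\<close> and \<open>Q\<close> are transposed Jacobian blocks and multiply
    \<open>C\<close> and \<open>D\<close> from the left.\<close>
  define P where "P = (\<chi> i l. L w (fst_dirs i) $ l)"
  define Q where "Q = (\<chi> i l. L w (snd_dirs i) $ l)"
  have "hessian all_dirs H w = block_matrix (A + P ** C) (- P) (Q ** C) (- Q)"
    by (simp add: vec_eq_sum_iff vec_eq_iff split_sum_all hessian_def H''_eq F''_eq H''_def A_def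
        C_def P_def Q_def all_dirs_def matrix_matrix_mult_def F''_expand[of _ _ "L w _"]
        inner_axis fst_dirs_def snd_dirs_def F''_zero flip: y_def)
  also have "\<dots> = block_matrix A (- P) 0 (- Q) ** block_matrix (mat 1) 0 (- C) (mat 1)"
    by (simp add: block_matrix_mult matrix_minus_mult_minus)
  finally have "det (hessian all_dirs H w) = det A * det (- Q)"
    by (simp add: det_mul det_block_matrix_upper det_block_matrix_unit_lower)
  \<comment> \<open>This is \<open>critical'\<close> for \<open>b = axis j 1\<close> and
    \<open>c = snd_dirs i\<close>, where the first component of \<open>c\<close> vanishes. The sign
    \<open>(-1) ^ CARD('k)\<close> comes from the determinant of \<open>- mat 1\<close>.\<close>
  moreover have "- Q ** D = - mat 1"
  proof -
    have "(\<Sum>l\<in>UNIV. L w (snd_dirs i) $ l * F'' (snd_dirs j) y (snd_dirs l)) =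
        (if i = j then 1 else 0)" for i j
      using critical'[of "axis j 1" "snd_dirs i"] F''_expand[of "snd_dirs j" 0 "L w (snd_dirs i)"]
      by (auto simp: snd_dirs_def inner_axis_axis F''_zero split: if_splits)
    then show ?thesis
      by (simp add: vec_eq_iff matrix_matrix_mult_def Q_def D_def hessian_def F''_eq mat_def
          sum_negf)
  qed
  then have "det (- Q) * det D = (-1) ^ CARD('k)"
    by (metis det_mul det_minus_mat_1)
  ultimately show "det (hessian all_dirs H w) * det (hessian snd_dirs F (fst w, \<Lambda> w)) =
      (-1) ^ CARD('k) * det (hessian fst_dirs F (fst w, \<Lambda> w))"
    by (simp add: A_def D_def y_def \<Phi>_def)
qed

section \<open>Sections of a convex body\<close>

text \<open>
  A support point of \<open>K\<close> in the direction given by the minimizer lies in the slice, because the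
  lifted support function touches the linear function of that point from above there.
\<close>

lemma slicing_support_at_minimizer:
  fixes K :: "'a::euclidean_space set" and \<nu> :: "'k::finite \<Rightarrow> 'a"
  assumes K: "compact K" "K \<noteq> {}"
    and min: "\<And>\<mu>. lifted_support K \<nu> v l - l \<bullet> q \<le> lifted_support K \<nu> v \<mu> - \<mu> \<bullet> q"
    and D: "(lifted_support K \<nu> v has_derivative D) (at l)"
  shows "D m = m \<bullet> q"
    and "slicing_support K \<nu> v q = ereal (lifted_support K \<nu> v l - l \<bullet> q)"
proof -
  define d where "d \<mu> = v + (\<Sum>j\<in>UNIV. \<mu> $ j *\<^sub>R \<nu> j)" for \<mu>
  have le: "x \<bullet> d \<mu> \<le> lifted_support K \<nu> v \<mu>" if "x \<in> K" for x \<mu>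
  proof -
    have "compact ((\<lambda>x. x \<bullet> d \<mu>) ` K)"
      by (intro compact_continuous_image continuous_intros K)
    then show ?thesis
      unfolding lifted_support_def support_fun_def d_def[symmetric]
      by (intro cSUP_upper that bounded_imp_bdd_above compact_imp_bounded)
  qed
  have D_q: "D = (\<lambda>m. m \<bullet> q)"
  proof -
    have "((\<lambda>\<mu>. lifted_support K \<nu> v \<mu> - \<mu> \<bullet> q) has_derivative (\<lambda>m. D m - m \<bullet> q)) (at l)"
      by (auto intro!: derivative_eq_intros D)
    from differential_zero_maxmin[OF UNIV_I open_UNIV this] min show ?thesis
      by (auto simp: fun_eq_iff)
  qed
  then show "D m = m \<bullet> q" by simp
  have "continuous_on K (\<lambda>x. x \<bullet> d l)"
    by (intro continuous_intros)
  then obtain x where x: "x \<in> K" and max: "\<And>z. z \<in> K \<Longrightarrow> z \<bullet> d l \<le> x \<bullet> d l"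
    using continuous_attains_sup[OF K, of "\<lambda>x. x \<bullet> d l"] by blast
  have x_eq: "lifted_support K \<nu> v l = x \<bullet> d l"
    unfolding lifted_support_def support_fun_def d_def[symmetric]
    using x max by (intro cSup_eq_maximum) auto
  \<comment> \<open>The difference is nonnegative and vanishes at \<open>l\<close>, so its
    derivative there is zero. Comparison with \<open>D_q\<close> in the direction
    \<open>axis j 1\<close> then yields the slice equation for \<nu> \<open>j\<close>.\<close>
  have "((\<lambda>\<mu>. lifted_support K \<nu> v \<mu> - x \<bullet> d \<mu>) has_derivative
      (\<lambda>m. D m - x \<bullet> (\<Sum>j\<in>UNIV. m $ j *\<^sub>R \<nu> j))) (at l)"
    unfolding d_def
    by (auto intro!: derivative_eq_intros D bounded_linear_imp_has_derivative bounded_linear_vec_nth)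
  from differential_zero_maxmin[OF UNIV_I open_UNIV this]
  have x_D: "D m = x \<bullet> (\<Sum>j\<in>UNIV. m $ j *\<^sub>R \<nu> j)" for m
    using le[OF x] x_eq by (auto simp: fun_eq_iff)
  have "x \<bullet> \<nu> j = q $ j" for j
  proof -
    have "(\<Sum>i\<in>UNIV. axis j (1::real) $ i *\<^sub>R \<nu> i) = \<nu> j"
      by (simp add: axis_def if_distrib[of "\<lambda>c. c *\<^sub>R _"] cong: if_cong)
    then show ?thesis
      using x_D[of "axis j 1"] D_q by (simp add: inner_axis')
  qed
  then have x_slice: "x \<in> slice K \<nu> q"
    using x by (simp add: slice_def)
  \<comment> \<open>On the slice, pairing with \<open>d l\<close> differs from pairing with
    \<open>v\<close> by the constant \<open>l \<bullet> q\<close>. The support inequality thus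
    bounds the supremum, and \<open>x\<close> attains the bound.\<close>
  have slice: "z \<bullet> d l = z \<bullet> v + l \<bullet> q" if "z \<in> slice K \<nu> q" for z
    using that
    by (simp add: slice_def d_def inner_add_right inner_sum_right inner_vec_def[of l])
  have "ereal (z \<bullet> v) \<le> ereal (lifted_support K \<nu> v l - l \<bullet> q)" if "z \<in> slice K \<nu> q" for z
    using slice[OF that] le[of z l] that by (simp add: slice_def)
  moreover have "lifted_support K \<nu> v l - l \<bullet> q = x \<bullet> v"
    using slice[OF x_slice] x_eq by simp
  ultimately show "slicing_support K \<nu> v q = ereal (lifted_support K \<nu> v l - l \<bullet> q)"
    unfolding slicing_support_def
    using x_slice by (intro antisym SUP_least SUP_upper2[of x]) auto
qed

text \<open>The first conjunct gives the Hessian of \<open>h\<close> its intended meaning: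
  \<open>real_of_ereal\<close> sends infinite values to 0 and \<open>deriv\<close> is total, so
  finiteness and \<open>C\<^sup>2\<close> regularity near the point are asserted as well.\<close>

theorem theorem9:
  fixes K :: "(real ^ 'n) set"
    and \<nu> :: "'k::finite \<Rightarrow> real ^ 'n"
    and e :: "'m::finite \<Rightarrow> real ^ 'n"
    and u :: "real ^ 'm" and p :: "real ^ 'k"
    and \<Lambda> :: "(real ^ 'm) \<times> (real ^ 'k) \<Rightarrow> real ^ 'k"
    and W V :: "((real ^ 'm) \<times> (real ^ 'k)) set"
  defines "F \<equiv> in_coords e (lifted_support K \<nu>)"
    and "h \<equiv> in_coords e (slicing_support K \<nu>)"
  assumes "convex_body K"
    and "orthonormal_family \<nu>"
    and "orthonormal_family e" and "span (range e) = (span (range \<nu>))\<^sup>\<bottom>"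
    and "open W" and "(u, p) \<in> W"
    and "\<And>v q l. (v, q) \<in> W \<Longrightarrow>
           is_arg_min (\<lambda>\<mu>. F (v, \<mu>) - \<mu> \<bullet> q) (\<lambda>_. True) l \<longleftrightarrow> l = \<Lambda> (v, q)"
    and "C_k_on 1 \<Lambda> W"
    and "open V" and "(u, \<Lambda> (u, p)) \<in> V" and "C_k_on 2 F V"
    and "invertible (hessian snd_dirs F (u, \<Lambda> (u, p)))"
  shows "(\<exists>N. open N \<and> (u, p) \<in> N \<and> (\<forall>w\<in>N. \<bar>h w\<bar> \<noteq> \<infinity>) \<and>
              C_k_on 2 (\<lambda>w. real_of_ereal (h w)) N) \<and>
         det (hessian all_dirs (\<lambda>w. real_of_ereal (h w)) (u, p)) =
           (-1) ^ CARD('k) * (det (hessian fst_dirs F (u, \<Lambda> (u, p)))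
             / det (hessian snd_dirs F (u, \<Lambda> (u, p))))"
proof -
  note W = assms(7,8) and arg_min = assms(9) and \<Lambda> = assms(10) and V = assms(11,12)
    and F_C2 = assms(13) and inv = assms(14)
  have K: "compact K" "K \<noteq> {}"
    using \<open>convex_body K\<close> by (auto simp: convex_body_def)
  \<comment> \<open>Shrinking \<open>W\<close> to the points whose minimizer lands in
    \<open>V\<close> makes \<open>F\<close> differentiable at each corresponding point; continuity
    of \<Lambda> keeps the set open.\<close>
  define N where "N = W \<inter> (\<lambda>x. (fst x, \<Lambda> x)) -` V"
  have "open N"
    unfolding N_def
    by (intro continuous_open_preimage continuous_intros C_1_on_continuous_on \<Lambda> W V)
  have N: "(u, p) \<in> N" "N \<subseteq> W" "\<And>x. x \<in> N \<Longrightarrow> (fst x, \<Lambda> x) \<in> V"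
    using W V by (auto simp: N_def)
  have \<Lambda>_N: "C_k_on 1 \<Lambda> N"
    using C_k_on_subset[OF \<Lambda> \<open>N \<subseteq> W\<close>] .
  have main: "frechet_derivative F (at (fst x, \<Lambda> x)) (0, b) = b \<bullet> snd x"
    "h x = ereal (F (fst x, \<Lambda> x) - \<Lambda> x \<bullet> snd x)" if "x \<in> N" for x b
  proof -
    obtain v q where x: "x = (v, q)" by (cases x)
    let ?y = "\<Sum>a\<in>UNIV. v $ a *\<^sub>R e a" and ?F' = "frechet_derivative F (at (v, \<Lambda> x))"
    have F_eq: "F (v, \<mu>) = lifted_support K \<nu> ?y \<mu>" for \<mu>
      by (simp add: F_def in_coords_def)
    have "x \<in> W" using that N by blast
    then have "is_arg_min (\<lambda>\<mu>. F (v, \<mu>) - \<mu> \<bullet> q) (\<lambda>_. True) (\<Lambda> x)"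
      using arg_min x by blast
    then have min: "F (v, \<Lambda> x) - \<Lambda> x \<bullet> q \<le> F (v, \<mu>) - \<mu> \<bullet> q" for \<mu>
      by (auto simp: is_arg_min_def not_less)
    have "(F has_derivative ?F') (at (v, \<Lambda> x))"
      using F_C2 N(3)[OF that] unfolding numeral_2_eq_2
      by (metis C_k_on_Suc_has_derivative fst_conv x)
    \<comment> \<open>Embedding the second variable with \<open>v\<close> fixed turns the total
      derivative of \<open>F\<close> into the derivative in \<lambda> to which the first-order
      condition applies.\<close>
    moreover have "((\<lambda>\<mu>. (v, \<mu>)) has_derivative (\<lambda>m. (0, m))) (at (\<Lambda> x))"
      by (auto intro!: derivative_eq_intros)
    ultimately have D: "((\<lambda>\<mu>. F (v, \<mu>)) has_derivative (\<lambda>m. ?F' (0, m))) (at (\<Lambda> x))"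
      by (rule has_derivative_compose[rotated])
    note * = slicing_support_at_minimizer[OF K min[unfolded F_eq] D[unfolded F_eq]]
    show "frechet_derivative F (at (fst x, \<Lambda> x)) (0, b) = b \<bullet> snd x"
      using *(1) x by simp
    show "h x = ereal (F (fst x, \<Lambda> x) - \<Lambda> x \<bullet> snd x)"
      using *(2) x by (simp add: h_def in_coords_def F_eq)
  qed
  note legendre = partial_legendre_transform[where H = "\<lambda>w. real_of_ereal (h w)",
      OF \<open>open N\<close> V(1) N(3) F_C2 \<Lambda>_N main(1)]
  have "C_k_on 2 (\<lambda>w. real_of_ereal (h w)) N"
    by (rule legendre(1)) (simp_all add: main)
  moreover have "\<forall>w\<in>N. \<bar>h w\<bar> \<noteq> \<infinity>"
    using main(2) by simp
  moreover have "det (hessian all_dirs (\<lambda>w. real_of_ereal (h w)) (u, p)) *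
      det (hessian snd_dirs F (u, \<Lambda> (u, p))) =
      (-1) ^ CARD('k) * det (hessian fst_dirs F (u, \<Lambda> (u, p)))"
    using legendre(2)[OF _ _ _ N(1)] by (simp add: main)
  moreover have "det (hessian snd_dirs F (u, \<Lambda> (u, p))) \<noteq> 0"
    using inv invertible_det_nz by blast
  ultimately show ?thesis
    using \<open>open N\<close> N(1) by (auto simp: nonzero_eq_divide_eq)
qed

end
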